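(* Let $\mathbb T=\prod_{i=1}^{d_1}[a_i,b_i]$ ($a_i<b_i$) be an interval or a rectangle in $\mathbb R^{d_1}$ and let $\mathbf X=\{\mathbf X(\mathrm t),\mathrm t\in\mathbb T\}$ be an $\mathbb R^d$-valued random field on a probability space $(\Omega,\mathscr F,\mathbb P)$ with a.s. continuous trajectories. For every $R\ge1$ denote $\mathbf\Omega_R:=\{\omega\in\Omega:\sup_{\mathrm t\in\mathbb T}\|\mathbf X(\mathrm t,\omega)\|\le R\}$. Assume that the following conditions hold: (C1) $\{(\mathbf\Omega_R,\mathbf X_R)\}_{R\ge1}$ is a localization of $\mathbf X$, i.e. $\mathbf X_R=\mathbf X$ on $\mathbf\Omega_R\subset\Omega$ for every $R\ge1$, and $\lim_{R\to\infty}\mathbb P(\mathbf\Omega_R)=1$. (C2) Given a discretization parameter $N\in\mathbb N_+$, denote by $\mathbf X^N$ (resp. $\mathbf X^N_R$) a numerical approximation of $\mathbf X$ (resp. $\mathbf X_R$). For sufficiently large $N$ and $R$, $\mathbf X^N_R=\mathbf X^N$ on $\mathbf\Omega_{R,N}:=\{\omega\in\Omega:\sup_{\mathrm t\in\mathbb T}\|\mathbf X^N(\mathrm t,\omega)\|\le R\}$. (C3) There exist $\upsilon_1>0$ and $q>0$ such that $\mathbb E[\|\mathbf X^N(\mathrm t)-\mathbf X(\mathrm t)\|^q]\le CN^{-q\upsilon_1}$ for all $\mathrm t\in\mathbb T$, with a constant $C$ independent of $N$ and $\mathrm t$. (C4) There exists $\upsilon_2>0$ such that for any $p\ge1$ there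 exists $C=C(p)$ independent of $N$ such that for any $\mathrm t_1,\mathrm t_2\in\mathbb T$, $\mathbb E[\|\mathbf X^N(\mathrm t_1)-\mathbf X^N(\mathrm t_2)\|^p]+\mathbb E[\|\mathbf X(\mathrm t_1)-\mathbf X(\mathrm t_2)\|^p]\le C\|\mathrm t_1-\mathrm t_2\|^{p\upsilon_2}$. Then, for $\mathrm t\in\mathbb T$, $$\limsup_{N\to\infty}\mathrm d_{\mathrm{TV}}(\mathbf X^N(\mathrm t),\mathbf X(\mathrm t))\le\limsup_{R\to\infty}\limsup_{N\to\infty}\mathrm d_{\mathrm{TV}}(\mathbf X^N_R(\mathrm t),\mathbf X_R(\mathrm t)).$$
   Context: $\|\cdot\|$ is the Euclidean norm. $\mathbf X_R$, $\mathbf X^N$, $\mathbf X^N_R$ ($R\ge1$, $N\in\mathbb N_+$) are $\mathbb R^d$-valued random fields indexed by $\mathbb T$ on $(\Omega,\mathscr F,\mathbb P)$; "numerical approximation" carries no requirement beyond the listed conditions. For $\mathbb R^d$-valued random variables $X,Y$, the total variation distance is $\mathrm d_{\mathrm{TV}}(X,Y)=2\sup_{A\in\mathscr B(\mathbb R^d)}|\mathbb P(X\in A)-\mathbb P(Y\in A)|=\sup_{\phi\in\Phi}|\mathbb E[\phi(X)]-\mathbb E[\phi(Y)]|$, where $\Phi$ is the set of continuous functions $\phi:\mathbb R^d\to\mathbb R$ bounded by $1$ and $\mathscr B(\mathbb R^d)$ is the Borel $\sigma$-algebra.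
   Formalization: The formal theorem also assumes that each numerical approximation X^N has a.s. continuous trajectories; without this, X^N may have unbounded paths at random times, so that Ω_{R,N} is empty, (C2) is vacuous and the claim fails. *)

theory Defs
  imports "HOL-Probability.Probability"
begin

definition random_field ::
  "'w measure \<Rightarrow> 'i set \<Rightarrow> ('i \<Rightarrow> 'w \<Rightarrow> 'b::topological_space) \<Rightarrow> bool" where
  "random_field M T X \<longleftrightarrow> (\<forall>t\<in>T. X t \<in> borel_measurable M)"

(* Also imposed on the approximations X^N: a condition on the event that sup_t |X^N(t)| <= R
   has content only for a regular version of X^N. An arbitrary version may have a.s.
   unbounded paths without any change in the laws of X^N(t), and that event is then null.
   The moment bound on increments provides a continuous modification by Kolmogorov's theorem. *)
definition as_continuous ::
  "'w measure \<Rightarrow> 'i::topological_space set \<Rightarrow> ('i \<Rightarrow> 'w \<Rightarrow> 'b::topological_space) \<Rightarrow> bool" where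
  "as_continuous M T X \<longleftrightarrow> (AE \<omega> in M. continuous_on T (\<lambda>t. X t \<omega>))"

(* The supremum is taken in ereal, so that paths unbounded on T have supremum infinity
   and are excluded for every R. *)
definition sup_le_event ::
  "'w measure \<Rightarrow> 'i set \<Rightarrow> ('i \<Rightarrow> 'w \<Rightarrow> 'b::real_normed_vector) \<Rightarrow> real \<Rightarrow> 'w set" where
  "sup_le_event M T X R = {\<omega> \<in> space M. (SUP t\<in>T. ereal (norm (X t \<omega>))) \<le> ereal R}"

(* Normalised with the factor 2, hence with values in [0, 2]. On a probability space the
   supremum is over a nonempty set of reals bounded by 1. *)
definition tv_dist ::
  "'w measure \<Rightarrow> ('w \<Rightarrow> 'b::topological_space) \<Rightarrow> ('w \<Rightarrow> 'b) \<Rightarrow> real" where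
  "tv_dist M X Y =
     2 * (SUP A\<in>sets borel. \<bar>\<P>(\<omega> in M. X \<omega> \<in> A) - \<P>(\<omega> in M. Y \<omega> \<in> A)\<bar>)"

end

(* On the events where sup |X| <= R and sup |X^N| <= R the localized fields coincide with the
   original ones, so d_TV(X^N(t), X(t)) exceeds d_TV(X^N_R(t), X_R(t)) by at most twice the
   probabilities of the complements. It remains to see that P(sup |X^N| > R) is small for large R
   uniformly in N. The moment bound on the increments and Kolmogorov's chaining along dyadic grids
   control sup_t |X^N(t) - X^N(a)|, and the strong error bound at the single point a makes the
   X^N(a) tight; the rate of convergence is irrelevant. The chaining is carried out on measurable
   sub-events, since the event sup |X^N| <= R itself need not be measurable. *)
theory Submission
  imports Defs
begin


section \<open>Markov's inequality and the union bound over all chaining levels\<close>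

lemma (in prob_space) prob_gt_le_moment:
  fixes Z :: "'a \<Rightarrow> real"
  assumes [measurable]: "Z \<in> borel_measurable M"
    and p: "p > 0" and l: "l > 0" and c: "c \<ge> 0"
    and mom: "(\<integral>\<^sup>+ x. ennreal (Z x powr p) \<partial>M) \<le> ennreal c"
  shows "prob {x \<in> space M. Z x > l} \<le> c / l powr p"
proof -
  have "emeasure M {x \<in> space M. Z x > l}
      \<le> emeasure M {x \<in> space M. 1 \<le> ennreal (1 / l powr p) * ennreal (Z x powr p)}"
  proof (rule emeasure_mono)
    show "{x \<in> space M. Z x > l}
        \<subseteq> {x \<in> space M. 1 \<le> ennreal (1 / l powr p) * ennreal (Z x powr p)}"
    proof safe
      fix x assume "l < Z x"
      then have "l powr p \<le> Z x powr p"
        using l p by (intro powr_mono2) auto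
      then have "1 \<le> 1 / l powr p * Z x powr p"
        using l by (simp add: field_simps)
      then show "1 \<le> ennreal (1 / l powr p) * ennreal (Z x powr p)"
        by (subst ennreal_mult[symmetric]) (auto simp: ennreal_ge_1)
    qed
  qed simp
  also have "\<dots> \<le> ennreal (1 / l powr p) * (\<integral>\<^sup>+ x. ennreal (Z x powr p) * indicator (space M) x \<partial>M)"
    by (rule nn_integral_Markov_inequality) auto
  also have "(\<integral>\<^sup>+ x. ennreal (Z x powr p) * indicator (space M) x \<partial>M)
      = (\<integral>\<^sup>+ x. ennreal (Z x powr p) \<partial>M)"
    by (rule nn_integral_cong) simp
  also have "ennreal (1 / l powr p) * \<dots> \<le> ennreal (1 / l powr p) * ennreal c"
    by (rule mult_left_mono[OF mom]) simp
  also have "\<dots> = ennreal (c / l powr p)"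
    using c by (subst ennreal_mult[symmetric]) auto
  finally show ?thesis
    using c by (simp add: emeasure_eq_measure)
qed

text \<open>By Markov and the union bound, level \<open>k\<close> fails with probability at most
  \<open>card (E k) * b k / (l * w k) powr p\<close>, which hypothesis \<open>sum\<close> turns into
  \<open>B / l powr p * (1/2) ^ k\<close>. The geometric series contributes the factor 2. Only
  countably many random variables are involved, so the good event is measurable without any
  regularity of paths.\<close>

lemma (in prob_space) prob_chaining_event:
  fixes Z :: "'e \<Rightarrow> 'a \<Rightarrow> real" and E :: "nat \<Rightarrow> 'e set"
  assumes meas[measurable]: "\<And>k e. e \<in> E k \<Longrightarrow> Z e \<in> borel_measurable M"
    and fin: "\<And>k. finite (E k)"
    and p: "p > 0" and l: "l > 0"
    and w: "\<And>k. w k > 0" and b: "\<And>k. b k \<ge> 0" and B: "B \<ge> 0"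
    and mom: "\<And>k e. e \<in> E k \<Longrightarrow> (\<integral>\<^sup>+ x. ennreal (Z e x powr p) \<partial>M) \<le> ennreal (b k)"
    and sum: "\<And>k. real (card (E k)) * b k \<le> B * (1/2) ^ k * w k powr p"
  shows "{x \<in> space M. \<forall>k. \<forall>e\<in>E k. Z e x \<le> l * w k} \<in> events" (is "?G \<in> _")
    and "1 - 2 * B / l powr p \<le> prob {x \<in> space M. \<forall>k. \<forall>e\<in>E k. Z e x \<le> l * w k}"
proof -
  define F where "F k e = {x \<in> space M. Z e x > l * w k}" for k e
  have F[measurable]: "F k e \<in> events" if "e \<in> E k" for k e
    using meas[OF that] unfolding F_def by measurable
  have U: "(\<Union>e\<in>E k. F k e) \<in> events" for k
    using F fin by (intro sets.finite_UN) auto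
  have level: "prob (\<Union>e\<in>E k. F k e) \<le> B / l powr p * (1/2) ^ k" for k
  proof -
    have "prob (\<Union>e\<in>E k. F k e) \<le> (\<Sum>e\<in>E k. prob (F k e))"
      using fin F by (intro finite_measure_subadditive_finite) auto
    also have "\<dots> \<le> (\<Sum>e\<in>E k. b k / (l * w k) powr p)"
      unfolding F_def using p l w b mom by (intro sum_mono prob_gt_le_moment meas) auto
    also have "\<dots> = real (card (E k)) * b k / (l powr p * w k powr p)"
      using l w[of k] by (simp add: powr_mult)
    also have "\<dots> \<le> (B * (1/2) ^ k * w k powr p) / (l powr p * w k powr p)"
      by (rule divide_right_mono[OF sum]) simp
    also have "\<dots> = B / l powr p * (1/2) ^ k"
      using w[of k] by simp
    finally show ?thesis .
  qed
  have summ: "summable (\<lambda>k. B / l powr p * (1/2) ^ k)"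
    by (intro summable_mult summable_geometric) simp
  have summ': "summable (\<lambda>k. prob (\<Union>e\<in>E k. F k e))"
    using level by (intro summable_comparison_test[OF _ summ]) auto
  have "prob (\<Union>k. \<Union>e\<in>E k. F k e) \<le> (\<Sum>k. prob (\<Union>e\<in>E k. F k e))"
    using U by (intro finite_measure_subadditive_countably summ') auto
  also have "\<dots> \<le> (\<Sum>k. B / l powr p * (1/2) ^ k)"
    by (rule suminf_le[OF level summ' summ])
  also have "\<dots> = 2 * B / l powr p"
    by (subst suminf_mult) (auto simp: suminf_geometric)
  finally have le: "prob (\<Union>k. \<Union>e\<in>E k. F k e) \<le> 2 * B / l powr p" .
  have G: "?G = space M - (\<Union>k. \<Union>e\<in>E k. F k e)"
    unfolding F_def by (fastforce simp: not_less)
  have UU: "(\<Union>k. \<Union>e\<in>E k. F k e) \<in> events"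
    using U by auto
  show "?G \<in> events"
    unfolding G using UU by auto
  show "1 - 2 * B / l powr p \<le> prob ?G"
    unfolding G using le prob_compl[OF UU] by simp
qed

section \<open>Deterministic ingredients: telescoping along a chain, and dyadic grids in a
  box\<close>

text \<open>Each telescoped difference is dominated by the whole series, and this bound survives the
  limit. In the chaining, \<open>f k\<close> is the value of a path at the level-\<open>k\<close>
  grid point and continuity supplies the convergence.\<close>

lemma norm_limit_minus_start_le:
  fixes f :: "nat \<Rightarrow> 'b::real_normed_vector"
  assumes lim: "f \<longlonglongrightarrow> y" and step: "\<And>k. norm (f (Suc k) - f k) \<le> w k"
    and w: "summable w"
  shows "norm (y - f 0) \<le> (\<Sum>k. w k)"
proof (rule LIMSEQ_le_const2)
  show "(\<lambda>n. norm (f n - f 0)) \<longlonglongrightarrow> norm (y - f 0)"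
    by (intro tendsto_intros lim)
  have "norm (f n - f 0) \<le> (\<Sum>k. w k)" for n
  proof -
    have "norm (f n - f 0) = norm (\<Sum>k<n. f (Suc k) - f k)"
      by (simp add: sum_lessThan_telescope)
    also have "\<dots> \<le> (\<Sum>k<n. norm (f (Suc k) - f k))"
      by (rule norm_sum)
    also have "\<dots> \<le> (\<Sum>k<n. w k)"
      by (intro sum_mono step)
    also have "\<dots> \<le> (\<Sum>k. w k)"
      by (rule sum_le_suminf[OF w]) (auto intro: order_trans[OF norm_ge_zero step])
    finally show ?thesis .
  qed
  then show "\<exists>N. \<forall>n\<ge>N. norm (f n - f 0) \<le> (\<Sum>k. w k)"
    by auto
qed

(* The cap at 2^k - 1 makes level 0 a single point even when u = 1. *)
definition dyadic_below :: "nat \<Rightarrow> real \<Rightarrow> real" where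
  "dyadic_below k u = of_int (min \<lfloor>2 ^ k * u\<rfloor> (2 ^ k - 1)) / 2 ^ k"

lemma dyadic_below_in:
  assumes "0 \<le> u" "u \<le> 1"
  shows "dyadic_below k u \<in> (\<lambda>j. of_int j / 2 ^ k) ` {0..<2 ^ k}"
proof -
  have "min \<lfloor>2 ^ k * u\<rfloor> (2 ^ k - 1) \<in> {0..<2 ^ k}"
    using assms by auto
  then show ?thesis
    unfolding dyadic_below_def by blast
qed

lemma abs_dyadic_below_diff_le:
  assumes "0 \<le> u" "u \<le> 1"
  shows "\<bar>dyadic_below k u - u\<bar> \<le> 1 / 2 ^ k"
proof -
  have u: "2 ^ k * u \<le> 2 ^ k"
    using assms by simp
  have f: "of_int \<lfloor>2 ^ k * u\<rfloor> \<le> 2 ^ k * u" "2 ^ k * u < of_int \<lfloor>2 ^ k * u\<rfloor> + 1"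
    by linarith+
  have "\<bar>of_int (min \<lfloor>2 ^ k * u\<rfloor> (2 ^ k - 1)) - 2 ^ k * u\<bar> \<le> 1"
  proof (cases "\<lfloor>2 ^ k * u\<rfloor> \<le> 2 ^ k - 1")
    case True
    then have "min \<lfloor>2 ^ k * u\<rfloor> (2 ^ k - 1) = \<lfloor>2 ^ k * u\<rfloor>" by simp
    then show ?thesis using f by linarith
  next
    \<comment> \<open>The cap is active only at \<open>u = 1\<close>, where the rounding error is
      exactly \<open>1 / 2 ^ k\<close>.\<close>
    case False
    then have "2 ^ k \<le> \<lfloor>2 ^ k * u\<rfloor>" by simp
    then have "2 ^ k * u = 2 ^ k"
      using u by (simp add: le_floor_iff)
    then show ?thesis using False by (simp add: min_def)
  qed
  then have "\<bar>of_int (min \<lfloor>2 ^ k * u\<rfloor> (2 ^ k - 1)) - 2 ^ k * u\<bar> / 2 ^ k \<le> 1 / 2 ^ k"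
    by (rule divide_right_mono) simp
  moreover have "dyadic_below k u - u = (of_int (min \<lfloor>2 ^ k * u\<rfloor> (2 ^ k - 1)) - 2 ^ k * u) / 2 ^ k"
    unfolding dyadic_below_def by (simp add: diff_divide_distrib)
  ultimately show ?thesis
    by (simp only: abs_divide) simp
qed

text \<open>Each coordinate is rescaled to the unit interval, rounded by \<open>dyadic_below\<close>
  and scaled back. All chains \<open>g 0 t, g 1 t, ...\<close> thus start at the corner
  \<open>a\<close> and converge to \<open>t\<close> geometrically, while the number of grid points
  grows only exponentially in the level.\<close>

lemma dyadic_grid:
  fixes a b :: "real ^ 'm"
  assumes ab: "\<And>i. a $ i < b $ i"
  obtains g :: "nat \<Rightarrow> real ^ 'm \<Rightarrow> real ^ 'm" and L :: real
  where "\<And>k t. t \<in> cbox a b \<Longrightarrow> g k t \<in> cbox a b"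
    and "\<And>k t. t \<in> cbox a b \<Longrightarrow> norm (g k t - t) \<le> L / 2 ^ k"
    and "\<And>t. t \<in> cbox a b \<Longrightarrow> g 0 t = a"
    and "\<And>k. finite (g k ` cbox a b)"
    and "\<And>k. card (g k ` cbox a b) \<le> (2 ^ CARD('m)) ^ k"
    and "L > 0"
proof -
  define u where "u t i = (t $ i - a $ i) / (b $ i - a $ i)" for t :: "real ^ 'm" and i
  define P where "P k v = (\<chi> i. a $ i + (b $ i - a $ i) * v i)"
    for k :: nat and v :: "'m \<Rightarrow> real"
  define g where "g k t = P k (\<lambda>i. dyadic_below k (u t i))" for k t
  \<comment> \<open>The sum of the side lengths appears because the Euclidean norm is estimated by
    the l1 norm, coordinate by coordinate.\<close>
  define L where "L = (\<Sum>i\<in>UNIV. b $ i - a $ i)"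
  have u: "0 \<le> u t i" "u t i \<le> 1" if "t \<in> cbox a b" for t i
    using that ab[of i] unfolding u_def mem_box_cart by (auto simp: field_simps)
  have tu: "t $ i = a $ i + (b $ i - a $ i) * u t i" for t i
    using ab[of i] unfolding u_def by simp
  have dy: "0 \<le> dyadic_below k (u t i)" "dyadic_below k (u t i) \<le> 1"
    if t: "t \<in> cbox a b" for k t i
  proof -
    obtain j :: int where j: "0 \<le> j" "j < 2 ^ k" "dyadic_below k (u t i) = of_int j / 2 ^ k"
      using dyadic_below_in[OF u[OF t], of k i] by auto
    have "real_of_int j \<le> of_int (2 ^ k)"
      using j(2) by (intro of_int_le_iff[THEN iffD2]) simp
    then show "0 \<le> dyadic_below k (u t i)" "dyadic_below k (u t i) \<le> 1"
      using j by simp_all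
  qed
  show ?thesis
  proof (rule that[of g L])
    show "g k t \<in> cbox a b" if "t \<in> cbox a b" for k t
    proof -
      have "0 \<le> (b $ i - a $ i) * dyadic_below k (u t i)"
          "(b $ i - a $ i) * dyadic_below k (u t i) \<le> b $ i - a $ i" for i
        using less_imp_le[OF ab[of i]] dy[OF that, of k i]
        by (auto intro!: mult_nonneg_nonneg mult_left_le)
      moreover have "g k t $ i = a $ i + (b $ i - a $ i) * dyadic_below k (u t i)" for i
        by (simp add: g_def P_def)
      ultimately show ?thesis
        unfolding mem_box_cart by (smt (verit))
    qed
    show "norm (g k t - t) \<le> L / 2 ^ k" if "t \<in> cbox a b" for k t
    proof -
      have "norm (g k t - t) \<le> (\<Sum>i\<in>UNIV. \<bar>(g k t - t) $ i\<bar>)"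
        by (rule norm_le_l1_cart)
      also have "\<dots> \<le> (\<Sum>i\<in>UNIV. (b $ i - a $ i) / 2 ^ k)"
      proof (rule sum_mono)
        fix i
        have "(g k t - t) $ i = (b $ i - a $ i) * (dyadic_below k (u t i) - u t i)"
          by (subst vector_minus_component, subst tu[of t]) (simp add: g_def P_def algebra_simps)
        then have "\<bar>(g k t - t) $ i\<bar> = (b $ i - a $ i) * \<bar>dyadic_below k (u t i) - u t i\<bar>"
          using ab[of i] by (simp add: abs_mult)
        also have "\<dots> \<le> (b $ i - a $ i) * (1 / 2 ^ k)"
          using ab[of i] by (intro mult_left_mono abs_dyadic_below_diff_le u that) auto
        finally show "\<bar>(g k t - t) $ i\<bar> \<le> (b $ i - a $ i) / 2 ^ k" by simp
      qed
      finally show ?thesis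
        unfolding L_def by (simp add: sum_divide_distrib)
    qed
    show "g 0 t = a" if "t \<in> cbox a b" for t
    proof -
      have "dyadic_below 0 (u t i) = 0" for i
        using dyadic_below_in[OF u[OF that], of 0 i] by auto
      then show ?thesis
        by (simp add: g_def P_def vec_eq_iff)
    qed
    \<comment> \<open>A grid point arises from one choice in \<open>V k\<close> per coordinate,
      which gives the count \<open>(2 ^ k) ^ CARD('m)\<close>.\<close>
    define V where "V k = (\<lambda>j. of_int j / 2 ^ k :: real) ` {0..<2 ^ k}" for k :: nat
    have sub: "g k ` cbox a b \<subseteq> P k ` (PiE UNIV (\<lambda>_. V k))" for k
      using dyadic_below_in[OF u] unfolding g_def V_def by (auto intro!: imageI)
    have finV: "finite (V k)" and cardV: "card (V k) \<le> 2 ^ k" for k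
      unfolding V_def by (auto intro: order_trans[OF card_image_le])
    have fin: "finite (PiE (UNIV :: 'm set) (\<lambda>_. V k))" for k
      using finV by (intro finite_PiE) auto
    show "finite (g k ` cbox a b)" for k
      by (rule finite_subset[OF sub]) (intro finite_imageI fin)
    show "card (g k ` cbox a b) \<le> (2 ^ CARD('m)) ^ k" for k
    proof -
      have "card (g k ` cbox a b) \<le> card (P k ` (PiE UNIV (\<lambda>_. V k)))"
        by (rule card_mono[OF _ sub]) (intro finite_imageI fin)
      also have "\<dots> \<le> card (PiE (UNIV :: 'm set) (\<lambda>_. V k))"
        by (rule card_image_le[OF fin])
      also have "\<dots> = card (V k) ^ CARD('m)"
        by (simp add: card_PiE)
      also have "\<dots> \<le> (2 ^ k) ^ CARD('m)"
        by (rule power_mono[OF cardV]) simp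
      finally show ?thesis
        by (simp add: power_mult[symmetric] mult.commute)
    qed
    show "L > 0"
      unfolding L_def using ab by (intro sum_pos) auto
  qed
qed

section \<open>Total variation under modification on events of small probability\<close>

lemma (in prob_space) abs_prob_diff_le:
  assumes [measurable]: "X \<in> borel_measurable M" "Y \<in> borel_measurable M" "A \<in> sets borel"
    and G: "G \<in> events" "\<And>x. x \<in> G \<Longrightarrow> X x = Y x" "1 - e \<le> prob G"
  shows "\<bar>\<P>(x in M. X x \<in> A) - \<P>(x in M. Y x \<in> A)\<bar> \<le> e"
proof -
  have *: "\<P>(x in M. U x \<in> A) \<le> \<P>(x in M. V x \<in> A) + e"
    if [measurable]: "U \<in> borel_measurable M" "V \<in> borel_measurable M"
      and eq: "\<And>x. x \<in> G \<Longrightarrow> U x = V x" for U V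
  proof -
    have "\<P>(x in M. U x \<in> A) \<le> prob ({x \<in> space M. V x \<in> A} \<union> (space M - G))"
      using G(1) eq by (intro finite_measure_mono) auto
    also have "\<dots> \<le> \<P>(x in M. V x \<in> A) + prob (space M - G)"
      using G(1) by (intro measure_Un_le) auto
    finally show ?thesis
      using G by (simp add: prob_compl)
  qed
  show ?thesis
    using *[OF assms(1,2) G(2)] *[OF assms(2,1) G(2)[symmetric]] by linarith
qed

text \<open>Replacing \<open>X\<close> by \<open>X'\<close> on \<open>G\<close> and \<open>Y\<close>
  by \<open>Y'\<close> on \<open>H\<close> costs \<open>e\<close> each in the difference of
  probabilities, for every Borel set. The normalisation of \<open>tv_dist\<close> doubles
  \<open>2 * e\<close> to \<open>4 * e\<close>.\<close>

lemma (in prob_space) tv_dist_le_add: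
  assumes [measurable]: "X \<in> borel_measurable M" "Y \<in> borel_measurable M"
      "X' \<in> borel_measurable M" "Y' \<in> borel_measurable M"
    and G: "G \<in> events" "\<And>x. x \<in> G \<Longrightarrow> X x = X' x" "1 - e \<le> prob G"
    and H: "H \<in> events" "\<And>x. x \<in> H \<Longrightarrow> Y x = Y' x" "1 - e \<le> prob H"
  shows "tv_dist M X Y \<le> tv_dist M X' Y' + 4 * e"
proof -
  let ?d = "\<lambda>X Y A. \<bar>\<P>(x in M. X x \<in> A) - \<P>(x in M. Y x \<in> A)\<bar>"
  \<comment> \<open>The supremum is one of reals, so each term lies below it only once boundedness
    is known.\<close>
  have "?d X' Y' A \<le> 1" for A
    by (smt (verit) measure_nonneg prob_le_1)
  then have bdd: "bdd_above (?d X' Y' ` sets borel)"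
    by (intro bdd_aboveI) auto
  have "(SUP A\<in>sets borel. ?d X Y A) \<le> (SUP A\<in>sets borel. ?d X' Y' A) + 2 * e"
  proof (rule cSUP_least)
    show "sets borel \<noteq> {}"
      using sets.empty_sets by blast
    fix A :: "'b set" assume A: "A \<in> sets borel"
    have "?d X Y A \<le> ?d X X' A + ?d X' Y' A + ?d Y Y' A"
      by linarith
    moreover have "?d X X' A \<le> e"
      by (rule abs_prob_diff_le[OF _ _ A G]) simp_all
    moreover have "?d Y Y' A \<le> e"
      by (rule abs_prob_diff_le[OF _ _ A H]) simp_all
    moreover have "?d X' Y' A \<le> (SUP A\<in>sets borel. ?d X' Y' A)"
      by (rule cSUP_upper[OF A bdd])
    ultimately show "?d X Y A \<le> (SUP A\<in>sets borel. ?d X' Y' A) + 2 * e"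
      by linarith
  qed
  then show ?thesis
    unfolding tv_dist_def by simp
qed

section \<open>Uniform bounds for suprema by Kolmogorov chaining, and tightness at one point\<close>

text \<open>Since moments of every order are controlled, \<open>p\<close> can be taken so large that
  the decay of the increments beats the number of grid pairs in any dimension. All constants come
  from bounds that are uniform in \<open>i\<close>, so one \<open>R\<close> serves the whole
  family.\<close>

lemma (in prob_space) uniform_sup_bound:
  fixes a b :: "real ^ 'm" and Y :: "'i \<Rightarrow> real ^ 'm \<Rightarrow> 'a \<Rightarrow> 'b::euclidean_space"
  assumes box: "\<And>i. a $ i < b $ i" and T: "T = cbox a b"
    and meas: "\<And>i. i \<in> I \<Longrightarrow> random_field M T (Y i)"
    and cont: "\<And>i. i \<in> I \<Longrightarrow> as_continuous M T (Y i)"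
    and v: "v > 0"
    and mom: "\<And>p. p \<ge> 1 \<Longrightarrow> \<exists>C\<ge>0. \<forall>i\<in>I. \<forall>s\<in>T. \<forall>t\<in>T.
        (\<integral>\<^sup>+ x. ennreal (norm (Y i s x - Y i t x) powr p) \<partial>M) \<le> ennreal (C * norm (s - t) powr (p * v))"
    and tight: "\<And>e. e > 0 \<Longrightarrow> \<exists>r. \<forall>i\<in>I. 1 - e \<le> prob {x \<in> space M. norm (Y i a x) \<le> r}"
    and e: "e > 0"
  shows "\<exists>R. \<forall>i\<in>I. \<exists>G\<in>events. 1 - e \<le> prob G \<and> G \<subseteq> sup_le_event M T (Y i) R"
proof -
  define n where "n = CARD('m)"
  obtain g :: "nat \<Rightarrow> real ^ 'm \<Rightarrow> real ^ 'm" and L :: real where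
      gT: "\<And>k t. t \<in> T \<Longrightarrow> g k t \<in> T"
      and gL: "\<And>k t. t \<in> T \<Longrightarrow> norm (g k t - t) \<le> L / 2 ^ k"
      and g0: "\<And>t. t \<in> T \<Longrightarrow> g 0 t = a"
      and gfin: "\<And>k. finite (g k ` T)"
      and gcard: "\<And>k. card (g k ` T) \<le> (2 ^ n) ^ k"
      and L: "L > 0"
    by (rule dyadic_grid[OF box, folded T n_def]) blast
  \<comment> \<open>These pairs include every chain link from \<open>g k t\<close> to
    \<open>g (Suc k) t\<close>, because both points are within \<open>L / 2 ^ k\<close> of
    \<open>t\<close>.\<close>
  define E where "E k = {(x, y) \<in> g k ` T \<times> g (Suc k) ` T. norm (y - x) \<le> 2 * L / 2 ^ k}" for k
  \<comment> \<open>The order is chosen so that half of the exponent \<open>p * v\<close> is at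
    least \<open>2 * n + 1\<close>: \<open>2 * n\<close> for the number of pairs and 1 for a
    summable factor \<open>(1/2) ^ k\<close>.\<close>
  define p where "p = 1 + 2 * (2 * real n + 1) / v"
  have p1: "p \<ge> 1" using v unfolding p_def by simp
  have pv: "p * v / 2 \<ge> 2 * real n + 1"
    using v unfolding p_def by (simp add: field_simps)
  obtain C where C: "C \<ge> 0" and momC: "\<And>i s t. i \<in> I \<Longrightarrow> s \<in> T \<Longrightarrow> t \<in> T \<Longrightarrow>
      (\<integral>\<^sup>+ x. ennreal (norm (Y i s x - Y i t x) powr p) \<partial>M) \<le> ennreal (C * norm (s - t) powr (p * v))"
    using mom[OF p1] by blast
  \<comment> \<open>The threshold at level \<open>k\<close> is \<open>l * \<theta> ^ k\<close>, that
    is, decay with half of the exponent \<open>v\<close>. The other half is reserved for counting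
    pairs.\<close>
  define \<theta> where "\<theta> = 2 powr (- v / 2)"
  have \<theta>: "\<theta> > 0" "\<theta> < 1"
    using v unfolding \<theta>_def by (auto simp: powr_less_one)
  define c where "c k = C * (2 * L / 2 ^ k) powr (p * v)" for k :: nat
  \<comment> \<open>The factor \<open>2 ^ n\<close> comes from the finer level \<open>Suc k\<close>
    in the count of pairs, the rest from the moment bound at distance
    \<open>2 * L / 2 ^ k\<close>.\<close>
  define B where "B = 2 ^ n * C * (2 * L) powr (p * v)"
  have B: "B \<ge> 0" using C unfolding B_def by simp
  have Esub: "E k \<subseteq> g k ` T \<times> g (Suc k) ` T" for k
    unfolding E_def by auto
  have Efin: "finite (E k)" for k
    by (rule finite_subset[OF Esub]) (intro finite_cartesian_product gfin)
  have Ecard: "real (card (E k)) \<le> 2 ^ n * 2 powr (2 * real n * real k)" for k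
  proof -
    have "card (E k) \<le> card (g k ` T \<times> g (Suc k) ` T)"
      by (rule card_mono[OF _ Esub]) (intro finite_cartesian_product gfin)
    also have "\<dots> \<le> (2 ^ n) ^ k * (2 ^ n) ^ Suc k"
      unfolding card_cartesian_product by (intro mult_mono gcard) auto
    also have "\<dots> = 2 ^ n * 2 ^ (2 * n * k)"
      by (simp add: power_mult[symmetric] power_add[symmetric])
    finally have "real (card (E k)) \<le> real (2 ^ n * 2 ^ (2 * n * k))"
      by (rule of_nat_mono)
    also have "\<dots> = 2 ^ n * 2 powr (real (2 * n * k))"
      by (subst powr_realpow) auto
    finally show ?thesis by simp
  qed
  \<comment> \<open>Up to \<open>B\<close>, the left side is 2 to the power
    \<open>2 * n * k - k * p * v\<close>. One half of \<open>k * p * v\<close> absorbs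
    \<open>2 * n * k\<close> and leaves \<open>- k\<close>; the other half is exactly
    \<open>(\<theta> ^ k) powr p\<close>.\<close>
  have sum: "real (card (E k)) * c k \<le> B * (1/2) ^ k * (\<theta> ^ k) powr p" for k
  proof -
    have "(2 * L / 2 ^ k) powr (p * v) = (2 * L) powr (p * v) / (2 ^ k) powr (p * v)"
      using L by (simp add: powr_divide)
    also have "(2 ^ k) powr (p * v) = 2 powr (k * (p * v))"
      by (simp add: powr_realpow[symmetric] powr_powr)
    finally have "real (card (E k)) * c k
        \<le> (2 ^ n * 2 powr (2 * real n * real k)) * (C * ((2 * L) powr (p * v) / 2 powr (k * (p * v))))"
      unfolding c_def using C Ecard[of k] by (intro mult_mono) auto
    also have "\<dots> = B * 2 powr (2 * real n * k - k * (p * v))"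
      unfolding B_def powr_diff by simp
    also have "\<dots> \<le> B * 2 powr (- real k - k * (p * v / 2))"
    proof -
      have "real k * (2 * real n + 1) \<le> real k * (p * v / 2)"
        by (rule mult_left_mono[OF pv]) simp
      then have "2 * real n * k - k * (p * v) \<le> - real k - k * (p * v / 2)"
        by (simp add: algebra_simps)
      then show ?thesis
        by (intro mult_left_mono[OF _ B] powr_mono) auto
    qed
    also have "2 powr (- real k - k * (p * v / 2)) = (1/2) ^ k * (\<theta> ^ k) powr p"
    proof -
      have "(1/2 :: real) ^ k = 2 powr (- real k)"
        by (simp add: powr_minus powr_realpow power_one_over inverse_eq_divide)
      moreover have "(\<theta> ^ k) powr p = 2 powr (- (k * (p * v / 2)))"
        unfolding \<theta>_def by (subst powr_realpow[symmetric]) (simp_all add: powr_powr mult_ac)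
      ultimately show ?thesis
        by (simp add: powr_add[symmetric])
    qed
    finally show ?thesis by simp
  qed
  \<comment> \<open>The lower bound 1 gives \<open>l \<le> l powr p\<close>, and
    \<open>4 * B / e\<close> makes the chaining failure at most \<open>e / 2\<close>. The other
    \<open>e / 2\<close> is spent on the starting point \<open>a\<close>.\<close>
  define l where "l = max 1 (4 * B / e)"
  have l: "l > 0" unfolding l_def by simp
  have "2 * B / l powr p \<le> 2 * B / l"
    using B powr_mono[OF p1, of l] unfolding l_def by (intro divide_left_mono) auto
  also have "\<dots> \<le> e / 2"
  proof -
    have "4 * B / e \<le> l" unfolding l_def by simp
    then show ?thesis using e l by (simp add: field_simps)
  qed
  finally have lB: "2 * B / l powr p \<le> e / 2" .
  obtain r where r: "\<And>i. i \<in> I \<Longrightarrow> 1 - e / 2 \<le> prob {x \<in> space M. norm (Y i a x) \<le> r}"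
    using tight[of "e / 2"] e by auto
  define W where "W = (\<Sum>k. l * \<theta> ^ k)"
  have W: "summable (\<lambda>k. l * \<theta> ^ k)"
    using \<theta> by (intro summable_mult summable_geometric) simp
  have aT: "a \<in> T"
    using box unfolding T mem_box_cart by (auto intro: less_imp_le)
  have "\<exists>G\<in>events. 1 - e \<le> prob G \<and> G \<subseteq> sup_le_event M T (Y i) (r + W)" if i: "i \<in> I" for i
  proof -
    have Ym: "Y i t \<in> borel_measurable M" if "t \<in> T" for t
      using meas[OF i] that unfolding random_field_def by blast
    have ET: "fst s \<in> T" "snd s \<in> T" "norm (snd s - fst s) \<le> 2 * L / 2 ^ k" if "s \<in> E k" for k s
      using that gT unfolding E_def by auto
    define Z where "Z s x = norm (Y i (snd s) x - Y i (fst s) x)" for s x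
    define G1 where "G1 = {x \<in> space M. \<forall>k. \<forall>s\<in>E k. Z s x \<le> l * \<theta> ^ k}"
    define G2 where "G2 = {x \<in> space M. norm (Y i a x) \<le> r}"
    have Zm: "Z s \<in> borel_measurable M" if "s \<in> E k" for k s
      unfolding Z_def using Ym[OF ET(1)[OF that]] Ym[OF ET(2)[OF that]] by measurable
    have Zmom: "(\<integral>\<^sup>+ x. ennreal (Z s x powr p) \<partial>M) \<le> ennreal (c k)" if "s \<in> E k" for k s
    proof -
      have "(\<integral>\<^sup>+ x. ennreal (Z s x powr p) \<partial>M) \<le> ennreal (C * norm (snd s - fst s) powr (p * v))"
        unfolding Z_def by (rule momC[OF i ET(2)[OF that] ET(1)[OF that]])
      also have "\<dots> \<le> ennreal (c k)"
        unfolding c_def using C ET(3)[OF that] p1 v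
        by (intro ennreal_leI mult_left_mono powr_mono2) auto
      finally show ?thesis .
    qed
    have c: "c k \<ge> 0" for k
      unfolding c_def using C by simp
    have p0: "p > 0" and w: "\<theta> ^ k > 0" for k
      using p1 \<theta>(1) by simp_all
    have G1: "G1 \<in> events"
      unfolding G1_def
      by (rule prob_chaining_event(1)[where b = c and B = B and p = p])
        (fact Zm Efin p0 l w c B Zmom sum)+
    have "1 - 2 * B / l powr p \<le> prob G1"
      unfolding G1_def
      by (rule prob_chaining_event(2)[where b = c]) (fact Zm Efin p0 l w c B Zmom sum)+
    then have pG1: "1 - e / 2 \<le> prob G1"
      using lB by linarith
    have G2: "G2 \<in> events" "1 - e / 2 \<le> prob G2"
      using Ym[OF aT] r[OF i] unfolding G2_def by measurable
    \<comment> \<open>The set of discontinuous paths need not be measurable, so a null set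
      containing it is removed instead.\<close>
    obtain N where N: "{x \<in> space M. \<not> continuous_on T (\<lambda>t. Y i t x)} \<subseteq> N" "N \<in> null_sets M"
      using cont[OF i] unfolding as_continuous_def by (auto elim!: AE_E intro: null_setsI)
    have "prob (G1 \<inter> G2 - N) = prob (G1 \<inter> G2)"
      using G1 G2 N by (intro measure_Diff_null_set) auto
    moreover have "prob (space M - G1 \<inter> G2) \<le> prob (space M - G1) + prob (space M - G2)"
      using G1 G2 by (subst Diff_Int) (intro measure_Un_le, auto)
    ultimately have "1 - e \<le> prob (G1 \<inter> G2 - N)"
      using G1 pG1 G2 by (simp add: prob_compl)
    moreover have "G1 \<inter> G2 - N \<in> events"
      using G1 G2 N by auto
    moreover have "G1 \<inter> G2 - N \<subseteq> sup_le_event M T (Y i) (r + W)"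
    proof
      fix x assume x: "x \<in> G1 \<inter> G2 - N"
      then have xM: "x \<in> space M" and ct: "continuous_on T (\<lambda>t. Y i t x)"
        using N unfolding G1_def by auto
      have "norm (Y i t x) \<le> r + W" if t: "t \<in> T" for t
      proof -
        have "(\<lambda>k. L * (1/2) ^ k) \<longlonglongrightarrow> 0"
          by (intro tendsto_mult_right_zero LIMSEQ_power_zero) simp
        then have "(\<lambda>k. L / 2 ^ k) \<longlonglongrightarrow> 0"
          by (simp add: power_divide)
        then have "(\<lambda>k. g k t - t) \<longlonglongrightarrow> 0"
          using gL[OF t] by (intro Lim_null_comparison[of "\<lambda>k. g k t - t"]) auto
        then have "(\<lambda>k. g k t) \<longlonglongrightarrow> t"
          by (simp add: LIM_zero_iff)
        then have lim: "(\<lambda>k. Y i (g k t) x) \<longlonglongrightarrow> Y i t x"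
          using gT[OF t] by (intro continuous_on_tendsto_compose[OF ct _ t]) auto
        have "(g k t, g (Suc k) t) \<in> E k" for k
        proof -
          have "norm (g (Suc k) t - g k t) \<le> norm (g (Suc k) t - t) + norm (g k t - t)"
            by norm
          also have "\<dots> \<le> L / 2 ^ Suc k + L / 2 ^ k"
            by (intro add_mono gL t)
          also have "\<dots> \<le> 2 * L / 2 ^ k"
            using L by (simp add: field_simps)
          finally show ?thesis
            using t unfolding E_def by auto
        qed
        then have "norm (Y i (g (Suc k) t) x - Y i (g k t) x) \<le> l * \<theta> ^ k" for k
          using x unfolding G1_def Z_def by fastforce
        from norm_limit_minus_start_le[OF lim this W]
        have "norm (Y i t x - Y i a x) \<le> W"
          unfolding W_def by (simp add: g0[OF t])
        moreover have "norm (Y i a x) \<le> r"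
          using x unfolding G2_def by simp
        ultimately show ?thesis
          by norm
      qed
      then show "x \<in> sup_le_event M T (Y i) (r + W)"
        using xM unfolding sup_le_event_def by (auto intro!: SUP_least)
    qed
    ultimately show ?thesis by blast
  qed
  then show ?thesis by blast
qed

lemma sup_le_event_mono: "R \<le> S \<Longrightarrow> sup_le_event M T X R \<subseteq> sup_le_event M T X S"
  unfolding sup_le_event_def by (auto intro: order_trans)

text \<open>If \<open>norm (X x) \<le> s\<close>, then \<open>norm (Y i x)\<close> exceeds
  \<open>s + l\<close> only when \<open>Y i x\<close> is further than \<open>l\<close> from
  \<open>X x\<close>. Markov makes this unlikely uniformly in \<open>i\<close>, and the gap
  \<open>e - d\<close> pays for it.\<close>

lemma (in prob_space) tight_of_moment_diff:
  fixes Y :: "'i \<Rightarrow> 'a \<Rightarrow> 'b::euclidean_space"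
  assumes [measurable]: "X \<in> borel_measurable M"
    and meas: "\<And>i. i \<in> I \<Longrightarrow> Y i \<in> borel_measurable M"
    and q: "q > 0" and C: "C \<ge> 0"
    and mom: "\<And>i. i \<in> I \<Longrightarrow> (\<integral>\<^sup>+ x. ennreal (norm (Y i x - X x) powr q) \<partial>M) \<le> ennreal C"
    and X: "1 - d \<le> prob {x \<in> space M. norm (X x) \<le> s}" and d: "d < e"
  shows "\<exists>r. \<forall>i\<in>I. 1 - e \<le> prob {x \<in> space M. norm (Y i x) \<le> r}"
proof -
  \<comment> \<open>Here \<open>l powr q\<close> is \<open>(C + 1) / (e - d)\<close>; adding 1 keeps
    \<open>l\<close> positive when \<open>C = 0\<close>.\<close>
  define l where "l = ((C + 1) / (e - d)) powr (1 / q)"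
  have l: "l > 0" using C d unfolding l_def by simp
  have "C / l powr q = C * (e - d) / (C + 1)"
    using q C d unfolding l_def by (simp add: powr_powr)
  also have "\<dots> \<le> e - d"
    using C d by (simp add: field_simps)
  finally have Cl: "C / l powr q \<le> e - d" .
  have "1 - e \<le> prob {x \<in> space M. norm (Y i x) \<le> s + l}" if i: "i \<in> I" for i
  proof -
    note [measurable] = meas[OF i]
    have "prob {x \<in> space M. norm (X x) \<le> s}
        \<le> prob ({x \<in> space M. norm (Y i x) \<le> s + l} \<union> {x \<in> space M. norm (Y i x - X x) > l})"
    proof (rule finite_measure_mono)
      show "{x \<in> space M. norm (X x) \<le> s}
          \<subseteq> {x \<in> space M. norm (Y i x) \<le> s + l} \<union> {x \<in> space M. norm (Y i x - X x) > l}"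
      proof safe
        fix x assume "norm (X x) \<le> s" "\<not> l < norm (Y i x - X x)"
        then show "norm (Y i x) \<le> s + l" by norm
      qed
    qed measurable
    also have "\<dots> \<le> prob {x \<in> space M. norm (Y i x) \<le> s + l}
        + prob {x \<in> space M. norm (Y i x - X x) > l}"
      by (intro measure_Un_le) measurable
    also have "prob {x \<in> space M. norm (Y i x - X x) > l} \<le> C / l powr q"
      by (rule prob_gt_le_moment[OF _ q l C mom[OF i]]) measurable
    finally show ?thesis using X Cl by linarith
  qed
  then show ?thesis by blast
qed

section \<open>Comparison of the two iterated limits\<close>

theorem proposition6p1:
  fixes M :: "'w measure"
    and a b :: "real ^ 'm"
    and T :: "(real ^ 'm) set"
    and X :: "real ^ 'm \<Rightarrow> 'w \<Rightarrow> real ^ 'n"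
    and XR :: "real \<Rightarrow> real ^ 'm \<Rightarrow> 'w \<Rightarrow> real ^ 'n"
    and XN :: "nat \<Rightarrow> real ^ 'm \<Rightarrow> 'w \<Rightarrow> real ^ 'n"
    and XNR :: "nat \<Rightarrow> real \<Rightarrow> real ^ 'm \<Rightarrow> 'w \<Rightarrow> real ^ 'n"
  assumes prob: "prob_space M"
    and box: "\<forall>i. a $ i < b $ i" "T = cbox a b"
    and X_field: "random_field M T X"
    and XR_field: "\<forall>R\<ge>1. random_field M T (XR R)"
    and XN_field: "\<forall>N\<ge>1. random_field M T (XN N)"
    and XNR_field: "\<forall>N\<ge>1. \<forall>R\<ge>1. random_field M T (XNR N R)"
    and X_cont: "as_continuous M T X"
    and XN_cont: "\<forall>N\<ge>1. as_continuous M T (XN N)"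
    and C1: "\<forall>R\<ge>1. \<forall>\<omega>\<in>sup_le_event M T X R. \<forall>t\<in>T. XR R t \<omega> = X t \<omega>"
            "((\<lambda>R. measure M (sup_le_event M T X R)) \<longlongrightarrow> 1) at_top"
    and C2: "\<exists>N0\<ge>1. \<exists>R0\<ge>1. \<forall>N\<ge>N0. \<forall>R\<ge>R0.
               \<forall>\<omega>\<in>sup_le_event M T (XN N) R. \<forall>t\<in>T. XNR N R t \<omega> = XN N t \<omega>"
    and C3: "\<exists>\<upsilon>1>0. \<exists>q>0. \<exists>C\<ge>0. \<forall>N\<ge>1. \<forall>t\<in>T.
               (\<integral>\<^sup>+ \<omega>. ennreal (norm (XN N t \<omega> - X t \<omega>) powr q) \<partial>M)
                 \<le> ennreal (C * real N powr (- q * \<upsilon>1))"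
    and C4: "\<exists>\<upsilon>2>0. \<forall>p\<ge>1. \<exists>C\<ge>0. \<forall>N\<ge>1. \<forall>t1\<in>T. \<forall>t2\<in>T.
               (\<integral>\<^sup>+ \<omega>. ennreal (norm (XN N t1 \<omega> - XN N t2 \<omega>) powr p) \<partial>M)
                 + (\<integral>\<^sup>+ \<omega>. ennreal (norm (X t1 \<omega> - X t2 \<omega>) powr p) \<partial>M)
                 \<le> ennreal (C * norm (t1 - t2) powr (p * \<upsilon>2))"
  shows "\<forall>t\<in>T.
    limsup (\<lambda>N. ereal (tv_dist M (XN N t) (X t)))
      \<le> Limsup at_top (\<lambda>R. limsup (\<lambda>N. ereal (tv_dist M (XNR N R t) (XR R t))))"
proof
  interpret prob_space M by (rule prob)
  fix t assume t: "t \<in> T"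
  have aT: "a \<in> T"
    using box by (auto simp: mem_box_cart intro: less_imp_le)
  \<comment> \<open>A non-measurable set has \<open>measure\<close> 0 by convention, so convergence
    to 1 already forces measurability for large \<open>R\<close>. The maximum with 0 secures a
    positive measure also when \<open>e \<ge> 1\<close>.\<close>
  have XE: "\<forall>\<^sub>F R in at_top. sup_le_event M T X R \<in> events \<and> 1 - e \<le> prob (sup_le_event M T X R)"
    if e: "e > 0" for e
  proof -
    have "\<forall>\<^sub>F R in at_top. max 0 (1 - e) < prob (sup_le_event M T X R)"
      by (rule order_tendstoD(1)[OF C1(2)]) (use e in auto)
    then show ?thesis
      by (rule eventually_mono) (use measure_notin_sets in fastforce)
  qed
  have tight: "\<exists>r. \<forall>N\<in>{1..}. 1 - e \<le> prob {x \<in> space M. norm (XN N a x) \<le> r}"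
    if e: "e > 0" for e
  proof -
    obtain R where R: "sup_le_event M T X R \<in> events" "1 - e / 2 \<le> prob (sup_le_event M T X R)"
      using eventually_happens[OF XE[of "e / 2"]] e by auto
    have Xa[measurable]: "X a \<in> borel_measurable M"
      using X_field aT unfolding random_field_def by blast
    have "sup_le_event M T X R \<subseteq> {x \<in> space M. norm (X a x) \<le> R}"
      unfolding sup_le_event_def using aT by (auto simp: SUP_le_iff)
    then have "prob (sup_le_event M T X R) \<le> prob {x \<in> space M. norm (X a x) \<le> R}"
      by (intro finite_measure_mono) measurable
    then have X: "1 - e / 2 \<le> prob {x \<in> space M. norm (X a x) \<le> R}"
      using R by linarith
    obtain v1 q C where vqC: "v1 > 0" "q > 0" "C \<ge> 0" and mom: "\<And>N. N \<ge> 1 \<Longrightarrow>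
        (\<integral>\<^sup>+ x. ennreal (norm (XN N a x - X a x) powr q) \<partial>M) \<le> ennreal (C * real N powr (- q * v1))"
      using C3 aT by blast
    have mom': "(\<integral>\<^sup>+ x. ennreal (norm (XN N a x - X a x) powr q) \<partial>M) \<le> ennreal C"
      if "N \<in> {1..}" for N
    proof -
      \<comment> \<open>For \<open>N \<ge> 1\<close> the rate is at most 1, which leaves a moment
        bound uniform in \<open>N\<close>.\<close>
      have "real N powr (- q * v1) \<le> real N powr 0"
        using that vqC by (intro powr_mono) auto
      then have "ennreal (C * real N powr (- q * v1)) \<le> ennreal C"
        using that vqC(3) by (intro ennreal_leI mult_left_le) auto
      then show ?thesis
        using mom[of N] that by (auto intro: order_trans)
    qed
    have "XN N a \<in> borel_measurable M" if "N \<in> {1..}" for N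
      using XN_field aT that unfolding random_field_def by auto
    from tight_of_moment_diff[where I = "{1..}" and Y = "\<lambda>N. XN N a" and e = e, OF Xa this vqC(2,3) mom' X] show ?thesis
      using e by simp
  qed
  obtain v2 where v2: "v2 > 0" and momsum: "\<And>p. p \<ge> 1 \<Longrightarrow> \<exists>C\<ge>0. \<forall>N\<ge>1. \<forall>t1\<in>T. \<forall>t2\<in>T.
      (\<integral>\<^sup>+ \<omega>. ennreal (norm (XN N t1 \<omega> - XN N t2 \<omega>) powr p) \<partial>M)
        + (\<integral>\<^sup>+ \<omega>. ennreal (norm (X t1 \<omega> - X t2 \<omega>) powr p) \<partial>M)
        \<le> ennreal (C * norm (t1 - t2) powr (p * v2))"
    using C4 by blast
  have mom: "\<exists>C\<ge>0. \<forall>N\<in>{1..}. \<forall>t1\<in>T. \<forall>t2\<in>T.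
      (\<integral>\<^sup>+ \<omega>. ennreal (norm (XN N t1 \<omega> - XN N t2 \<omega>) powr p) \<partial>M)
        \<le> ennreal (C * norm (t1 - t2) powr (p * v2))" if p: "p \<ge> 1" for p
  proof -
    from momsum[OF p] obtain C where C: "C \<ge> 0" and le: "\<And>N t1 t2. N \<ge> 1 \<Longrightarrow> t1 \<in> T \<Longrightarrow> t2 \<in> T \<Longrightarrow>
        (\<integral>\<^sup>+ \<omega>. ennreal (norm (XN N t1 \<omega> - XN N t2 \<omega>) powr p) \<partial>M)
          + (\<integral>\<^sup>+ \<omega>. ennreal (norm (X t1 \<omega> - X t2 \<omega>) powr p) \<partial>M)
          \<le> ennreal (C * norm (t1 - t2) powr (p * v2))"
      by blast
    show ?thesis
    proof (intro exI[of _ C] conjI ballI)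
      fix N :: nat and t1 t2 assume N: "N \<in> {1..}" and t12: "t1 \<in> T" "t2 \<in> T"
      show "(\<integral>\<^sup>+ \<omega>. ennreal (norm (XN N t1 \<omega> - XN N t2 \<omega>) powr p) \<partial>M)
          \<le> ennreal (C * norm (t1 - t2) powr (p * v2))"
        by (rule order_trans[OF add_increasing2[OF zero_le order_refl] le]) (use N t12 in auto)
    qed (rule C)
  qed
  obtain N0 R0 where N0: "N0 \<ge> (1::nat)" and R0: "R0 \<ge> (1::real)"
    and loc: "\<And>N R \<omega> t. N \<ge> N0 \<Longrightarrow> R \<ge> R0 \<Longrightarrow> \<omega> \<in> sup_le_event M T (XN N) R \<Longrightarrow> t \<in> T \<Longrightarrow>
        XNR N R t \<omega> = XN N t \<omega>"
    using C2 by blast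
  let ?LN = "\<lambda>N. ereal (tv_dist M (XN N t) (X t))"
  let ?RN = "\<lambda>R N. ereal (tv_dist M (XNR N R t) (XR R t))"
  show "limsup ?LN \<le> Limsup at_top (\<lambda>R. limsup (?RN R))"
  proof (rule ereal_le_epsilon2)
    fix d :: real assume d: "0 < d"
    \<comment> \<open>This matches the loss \<open>4 * e\<close> in
      \<open>tv_dist_le_add\<close>.\<close>
    define e where "e = d / 4"
    have e: "e > 0" using d unfolding e_def by simp
    obtain R1 where R1: "\<And>N. N \<in> {1..} \<Longrightarrow>
        \<exists>G\<in>events. 1 - e \<le> prob G \<and> G \<subseteq> sup_le_event M T (XN N) R1"
      using uniform_sup_bound[where I = "{1..}" and Y = XN, OF _ box(2) _ _ v2 mom tight e]
        box(1) XN_field XN_cont by (auto simp del: One_nat_def) blast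
    \<comment> \<open>\<open>R\<close> is fixed before \<open>N\<close> grows. This is possible
      because \<open>R1\<close> depends on \<open>e\<close> alone and serves all
      \<open>N \<ge> 1\<close>.\<close>
    have "\<forall>\<^sub>F R in at_top. limsup ?LN \<le> limsup (?RN R) + ereal d"
      using XE[OF e] eventually_ge_at_top[of R0] eventually_ge_at_top[of R1]
    proof eventually_elim
      case (elim R)
      then have R: "R \<ge> 1" using R0 by simp
      have "\<forall>\<^sub>F N in sequentially. ?LN N \<le> ?RN R N + ereal d"
        using eventually_ge_at_top[of N0]
      proof eventually_elim
        case N: (elim N)
        then have N1: "N \<ge> 1" using N0 by simp
        obtain G where G: "G \<in> events" "1 - e \<le> prob G" "G \<subseteq> sup_le_event M T (XN N) R1"
          using R1[of N] N1 by auto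
        \<comment> \<open>For the approximation, the measurable sub-event \<open>G\<close> is used;
          since \<open>R \<ge> R1\<close>, the localization applies on it. For \<open>X\<close>, the
          event \<open>sup_le_event M T X R\<close> itself is measurable by the choice of
          \<open>R\<close>.\<close>
        have "tv_dist M (XN N t) (X t) \<le> tv_dist M (XNR N R t) (XR R t) + 4 * e"
        proof (rule tv_dist_le_add)
          show "XN N t x = XNR N R t x" if "x \<in> G" for x
            using loc[OF N elim(2) _ t, of x] that G(3) sup_le_event_mono[OF elim(3)] by fastforce
          show "X t x = XR R t x" if "x \<in> sup_le_event M T X R" for x
            using C1(1) R that t by simp
        qed (use G elim X_field XR_field XN_field XNR_field N1 R t in \<open>auto simp: random_field_def\<close>)
        then show ?case unfolding e_def by simp
      qed
      then have "limsup ?LN \<le> limsup (\<lambda>N. ?RN R N + ereal d)"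
        by (rule Limsup_mono)
      also have "\<dots> = limsup (?RN R) + ereal d"
        by (intro Limsup_add_ereal_right) auto
      finally show ?case .
    qed
    then have "Limsup at_top (\<lambda>R::real. limsup ?LN) \<le> Limsup at_top (\<lambda>R. limsup (?RN R) + ereal d)"
      by (rule Limsup_mono)
    also have "\<dots> = Limsup at_top (\<lambda>R. limsup (?RN R)) + ereal d"
      by (intro Limsup_add_ereal_right) auto
    \<comment> \<open>The left side does not involve \<open>R\<close>, and \<open>at_top\<close> on
      the reals is a proper filter.\<close>
    also have "Limsup at_top (\<lambda>R::real. limsup ?LN) = limsup ?LN"
      by (rule Limsup_const) simp
    finally show "limsup ?LN \<le> Limsup at_top (\<lambda>R. limsup (?RN R)) + ereal d" .
  qed
qed

end
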